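(* Let $\mathcal{T},\mathcal{A}\in\Pi_3$, and let $V:L_2\to\mathbb{R}^+$ (nonnegative reals) satisfy $V(0)=0$ and admit a derivative $\dot V$ along solutions of the partial integral equation (PIE) $\mathcal{T}\dot{\mathbf{x}}=\mathcal{A}\mathbf{x}$ (as defined in the context). Then the PIE is: (1) Lyapunov PIE to PDE stable if $V$ is PDE positive and PIE bounded and $\dot V$ is negative semidefinite; (2) Lyapunov PIE stable if $V$ is PIE positive and PIE bounded and $\dot V$ is negative semidefinite; (3) Lyapunov PDE stable if $V$ is PDE positive and PDE bounded and $\dot V$ is negative semidefinite; (4) Lyapunov PDE to PIE stable if $V$ is PIE positive and PDE bounded and $\dot V$ is negative semidefinite.
   Context: $L_2$ denotes the real Hilbert space $L_2([0,1];\mathbb{R}^m)$ with inner product $\langle\cdot,\cdot\rangle$ and norm $\|\cdot\|$. A partial integral (PI) operator is a bounded linear operator $\mathcal{P}:L_2\to L_2$ of the form $(\mathcal{P}\mathbf{x})(s)=R_0(s)\mathbf{x}(s)+\int_0^s R_1(s,\theta)\mathbf{x}(\theta)\,d\theta+\int_s^1R_2(s,\theta)\mathbf{x}(\theta)\,d\theta$ with (matrix-valued) $R_0\in L_\infty$ and $R_1,R_2\in L_2$; $\Pi_3$ is the set of all such operators. A solution of $\mathcal{T}\dot{\mathbf{x}}=\mathcal{A}\mathbf{x}$ is a differentiable function $\mathbf{x}:[0,\infty)\to L_2$ with $\mathcal{T}\dot{\mathbf{x}}(t)=\mathcal{A}\mathbf{x}(t)$ for all $t\ge 0$. (When the PIE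 comes from a classically well-posed PDE, $\mathcal{T}\mathbf{x}(t)$ is the PDE state; this only motivates the terminology.) Derivative along solutions: $V$ is assumed sufficiently regular, meaning that $t\mapsto V(\mathbf{x}(t))$ is continuous for every solution, and that there is a function $\dot V:L_2\to\mathbb{R}$ with $\dot V(\mathbf{x})=\lim_{h\to0^+}\frac{V(\hat{\mathbf{x}}(h))-V(\mathbf{x})}{h}$ for every $\mathbf{x}\in L_2$ and every solution $\hat{\mathbf{x}}$ with $\hat{\mathbf{x}}(0)=\mathbf{x}$. Properties (each inequality for all $\mathbf{x}\in L_2$): $V$ is PDE positive if $V(\mathbf{x})\ge\epsilon\|\mathcal{T}\mathbf{x}\|^2$ for some $\epsilon>0$; PIE positive if $V(\mathbf{x})\ge\epsilon\|\mathbf{x}\|^2$ for some $\epsilon>0$; PIE bounded if $V(\mathbf{x})\le C\|\mathbf{x}\|^2$ for some $C>0$; PDE bounded if $V(\mathbf{x})\le C\|\mathcal{T}\mathbf{x}\|^2$ for some $C>0$. $\dot V$ is negative semidefinite if $\dot V(\mathbf{x})\le0$. Stability: the PIE is called - Lyapunov PIE to PDE stable if there is $C>0$ such that every solution satisfies $\|\mathcal{T}\mathbf{x}(t)\|\le C\|\mathbf{x}(0)\|$ for all $t\ge0$; - Lyapunov PIE stable if there is $C>0$ such that every solution satisfies $\|\mathbf{x}(t)\|\le C\|\mathbf{x}(0)\|$ for all $t\ge0$; - Lyapunov PDE stable if there is $C>0$ such that every solution satisfies $\|\mathcal{T}\mathbf{x}(t)\|\le C\|\mathcal{T}\mathbf{x}(0)\|$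 for all $t\ge0$; - Lyapunov PDE to PIE stable if there is $C>0$ such that every solution satisfies $\|\mathbf{x}(t)\|\le C\|\mathcal{T}\mathbf{x}(0)\|$ for all $t\ge0$. *)

theory Defs
  imports "HOL-Analysis.Analysis"
begin

abbreviation unit_leb :: "real measure" where
  "unit_leb \<equiv> lebesgue_on {0..1}"

definition square_integrable :: "'a::euclidean_space measure \<Rightarrow> ('a \<Rightarrow> 'b::euclidean_space) \<Rightarrow> bool" where
  "square_integrable M f \<longleftrightarrow> f \<in> borel_measurable M \<and> integrable M (\<lambda>s. (norm (f s))\<^sup>2)"

lemma square_integrable_zero: "square_integrable M (\<lambda>_. 0)"
  by (simp add: square_integrable_def)

lemma square_integrable_add:
  assumes "square_integrable M f" "square_integrable M g"
  shows "square_integrable M (\<lambda>s. f s + g s)"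
proof -
  have "integrable M (\<lambda>s. 2 * (norm (f s))\<^sup>2 + 2 * (norm (g s))\<^sup>2)"
    using assms by (simp add: square_integrable_def)
  moreover have "(norm (f s + g s))\<^sup>2 \<le> 2 * (norm (f s))\<^sup>2 + 2 * (norm (g s))\<^sup>2" for s
  proof -
    have "(norm (f s + g s))\<^sup>2 \<le> (norm (f s) + norm (g s))\<^sup>2"
      by (simp add: norm_triangle_ineq power_mono)
    also have "\<dots> \<le> 2 * (norm (f s))\<^sup>2 + 2 * (norm (g s))\<^sup>2"
      using sum_squares_bound[of "norm (f s)" "norm (g s)"] by (simp add: power2_sum)
    finally show ?thesis .
  qed
  ultimately have "integrable M (\<lambda>s. (norm (f s + g s))\<^sup>2)"
    using assms by (elim Bochner_Integration.integrable_bound) (auto simp: square_integrable_def)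
  then show ?thesis
    using assms by (auto simp: square_integrable_def)
qed

lemma square_integrable_scaleR:
  assumes "square_integrable M f"
  shows "square_integrable M (\<lambda>s. c *\<^sub>R f s)"
  using assms by (auto simp: square_integrable_def power_mult_distrib)

lemma square_integrable_uminus:
  assumes "square_integrable M f"
  shows "square_integrable M (\<lambda>s. - f s)"
  using assms by (auto simp: square_integrable_def)

lemma square_integrable_diff:
  assumes "square_integrable M f" "square_integrable M g"
  shows "square_integrable M (\<lambda>s. f s - g s)"
  using square_integrable_add[OF assms(1) square_integrable_uminus[OF assms(2)]] by simp

lemma square_integrable_inner:
  assumes "square_integrable M f" "square_integrable M g"
  shows "integrable M (\<lambda>s. f s \<bullet> g s)"
proof -
  have "integrable M (\<lambda>s. (norm (f s))\<^sup>2 + (norm (g s))\<^sup>2)"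
    using assms by (simp add: square_integrable_def)
  moreover have "\<bar>f s \<bullet> g s\<bar> \<le> (norm (f s))\<^sup>2 + (norm (g s))\<^sup>2" for s
  proof -
    have "2 * (norm (f s) * norm (g s)) \<le> (norm (f s))\<^sup>2 + (norm (g s))\<^sup>2"
      using sum_squares_bound[of "norm (f s)" "norm (g s)"] by simp
    moreover have "0 \<le> norm (f s) * norm (g s)" by simp
    ultimately show ?thesis
      using Cauchy_Schwarz_ineq2[of "f s" "g s"] by linarith
  qed
  ultimately show ?thesis
    using assms by (elim Bochner_Integration.integrable_bound) (auto simp: square_integrable_def)
qed

definition L2_rel :: "(real \<Rightarrow> real ^ 'm::finite) \<Rightarrow> (real \<Rightarrow> real ^ 'm) \<Rightarrow> bool" where
  "L2_rel f g \<longleftrightarrow> square_integrable unit_leb f \<and> square_integrable unit_leb g \<and>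
     (AE s in unit_leb. f s = g s)"

lemma part_equivp_L2_rel: "part_equivp (L2_rel :: (real \<Rightarrow> real ^ 'm::finite) \<Rightarrow> _)"
proof (rule part_equivpI)
  show "\<exists>f :: real \<Rightarrow> real ^ 'm. L2_rel f f"
    using square_integrable_zero by (auto simp: L2_rel_def)
  show "symp (L2_rel :: (real \<Rightarrow> real ^ 'm) \<Rightarrow> _)"
    by (auto simp: symp_def L2_rel_def elim!: AE_mp)
  show "transp (L2_rel :: (real \<Rightarrow> real ^ 'm) \<Rightarrow> _)"
    unfolding transp_def L2_rel_def by (auto elim: AE_mp)
qed

quotient_type 'm L2 = "real \<Rightarrow> real ^ 'm::finite" / partial: L2_rel
  by (rule part_equivp_L2_rel)

instantiation L2 :: (finite) real_vector
begin

lift_definition zero_L2 :: "'a L2" is "\<lambda>_. 0"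
  by (simp add: L2_rel_def square_integrable_zero)

lift_definition plus_L2 :: "'a L2 \<Rightarrow> 'a L2 \<Rightarrow> 'a L2" is "\<lambda>f g s. f s + g s"
  unfolding L2_rel_def by (auto simp: square_integrable_add elim: AE_mp)

lift_definition uminus_L2 :: "'a L2 \<Rightarrow> 'a L2" is "\<lambda>f s. - f s"
  unfolding L2_rel_def by (auto simp: square_integrable_uminus)

lift_definition minus_L2 :: "'a L2 \<Rightarrow> 'a L2 \<Rightarrow> 'a L2" is "\<lambda>f g s. f s - g s"
  unfolding L2_rel_def by (auto simp: square_integrable_diff elim: AE_mp)

lift_definition scaleR_L2 :: "real \<Rightarrow> 'a L2 \<Rightarrow> 'a L2" is "\<lambda>c f s. c *\<^sub>R f s"
  unfolding L2_rel_def by (auto simp: square_integrable_scaleR elim: AE_mp)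

instance
proof
  fix x y z :: "'a L2" and a b :: real
  show "x + y + z = x + (y + z)"
    by transfer (auto simp: L2_rel_def square_integrable_add add.assoc)
  show "x + y = y + x"
    by transfer (auto simp: L2_rel_def square_integrable_add add.commute)
  show "0 + x = x"
    by transfer (auto simp: L2_rel_def)
  show "- x + x = 0"
    by transfer (auto simp: L2_rel_def square_integrable_zero)
  show "x - y = x + - y"
    by transfer (auto simp: L2_rel_def square_integrable_diff)
  show "a *\<^sub>R (x + y) = a *\<^sub>R x + a *\<^sub>R y"
    by transfer (auto simp: L2_rel_def scaleR_add_right
        intro!: square_integrable_add square_integrable_scaleR)
  show "(a + b) *\<^sub>R x = a *\<^sub>R x + b *\<^sub>R x"
    by transfer (auto simp: L2_rel_def scaleR_add_left
        intro!: square_integrable_add square_integrable_scaleR)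
  show "a *\<^sub>R b *\<^sub>R x = (a * b) *\<^sub>R x"
    by transfer (auto simp: L2_rel_def intro!: square_integrable_scaleR)
  show "1 *\<^sub>R x = x"
    by transfer (auto simp: L2_rel_def)
qed

end

instantiation L2 :: (finite) real_inner
begin

lift_definition inner_L2 :: "'a L2 \<Rightarrow> 'a L2 \<Rightarrow> real" is "\<lambda>f g. \<integral>s. f s \<bullet> g s \<partial>unit_leb"
proof -
  fix f f' g g' :: "real \<Rightarrow> real ^ 'a"
  assume *: "L2_rel f f'" "L2_rel g g'"
  show "(\<integral>s. f s \<bullet> g s \<partial>unit_leb) = (\<integral>s. f' s \<bullet> g' s \<partial>unit_leb)"
  proof (rule integral_cong_AE)
    show "(\<lambda>s. f s \<bullet> g s) \<in> borel_measurable unit_leb" "(\<lambda>s. f' s \<bullet> g' s) \<in> borel_measurable unit_leb"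
      using * square_integrable_inner borel_measurable_integrable unfolding L2_rel_def by blast+
    show "AE s in unit_leb. f s \<bullet> g s = f' s \<bullet> g' s"
      using * unfolding L2_rel_def by (auto elim: AE_mp)
  qed
qed

definition norm_L2 :: "'a L2 \<Rightarrow> real" where
  "norm_L2 x = sqrt (x \<bullet> x)"

definition dist_L2 :: "'a L2 \<Rightarrow> 'a L2 \<Rightarrow> real" where
  "dist_L2 x y = norm (x - y)"

definition sgn_L2 :: "'a L2 \<Rightarrow> 'a L2" where
  "sgn_L2 x = x /\<^sub>R norm x"

definition uniformity_L2 :: "('a L2 \<times> 'a L2) filter" where
  "uniformity_L2 = (INF e\<in>{0 <..}. principal {(x, y). dist x y < e})"

definition open_L2 :: "'a L2 set \<Rightarrow> bool" where
  "open_L2 U \<longleftrightarrow> (\<forall>x\<in>U. eventually (\<lambda>(x', y). x' = x \<longrightarrow> y \<in> U) uniformity)"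

instance
proof
  fix x y z :: "'a L2" and a :: real
  show "x \<bullet> y = y \<bullet> x"
    by transfer (simp add: inner_commute)
  show "(x + y) \<bullet> z = x \<bullet> z + y \<bullet> z"
    by transfer (simp add: L2_rel_def inner_add_left square_integrable_inner)
  show "a *\<^sub>R x \<bullet> y = a * (x \<bullet> y)"
    by transfer (simp add: L2_rel_def)
  show "0 \<le> x \<bullet> x"
    by transfer (simp add: L2_rel_def)
  show "x \<bullet> x = 0 \<longleftrightarrow> x = 0"
  proof transfer
    fix f :: "real \<Rightarrow> real ^ 'a"
    assume "L2_rel f f"
    then have f: "square_integrable unit_leb f" by (simp add: L2_rel_def)
    have "(\<integral>s. f s \<bullet> f s \<partial>unit_leb) = 0 \<longleftrightarrow> (AE s in unit_leb. f s \<bullet> f s = 0)"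
      by (rule integral_nonneg_eq_0_iff_AE) (simp_all add: square_integrable_inner[OF f f])
    then show "(\<integral>s. f s \<bullet> f s \<partial>unit_leb) = 0 \<longleftrightarrow> L2_rel f (\<lambda>_. 0)"
      using f by (simp add: L2_rel_def square_integrable_zero)
  qed
qed (simp_all add: norm_L2_def dist_L2_def sgn_L2_def uniformity_L2_def open_L2_def)

end

definition ess_bounded :: "(real \<Rightarrow> real ^ 'm::finite ^ 'm) \<Rightarrow> bool" where
  "ess_bounded R \<longleftrightarrow> R \<in> borel_measurable unit_leb \<and> (\<exists>B. AE s in unit_leb. norm (R s) \<le> B)"

text \<open>The kernels are total functions on the unit square; each one only matters on its own
  triangle. The function \<^term>\<open>rep_L2\<close> chooses a representative of a class, and the defining
  equation does not depend on that choice because it is only required almost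
  everywhere. The two integrals exist for almost every \<^term>\<open>s\<close>, since almost every slice of a
  square integrable kernel is square integrable.\<close>

definition PI_ops :: "('m::finite L2 \<Rightarrow> 'm L2) set" ("\<Pi>\<^sub>3") where
  "\<Pi>\<^sub>3 = {P. bounded_linear P \<and>
     (\<exists>(R0 :: real \<Rightarrow> real ^ 'm ^ 'm) (R1 :: real \<times> real \<Rightarrow> real ^ 'm ^ 'm)
         (R2 :: real \<times> real \<Rightarrow> real ^ 'm ^ 'm).
        ess_bounded R0 \<and>
        square_integrable (lebesgue_on ({0..1} \<times> {0..1})) R1 \<and>
        square_integrable (lebesgue_on ({0..1} \<times> {0..1})) R2 \<and>
        (\<forall>x. AE s in unit_leb.
           rep_L2 (P x) s = R0 s *v rep_L2 x s
             + (LINT \<theta>:{0..s}|lebesgue. R1 (s, \<theta>) *v rep_L2 x \<theta>)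
             + (LINT \<theta>:{s..1}|lebesgue. R2 (s, \<theta>) *v rep_L2 x \<theta>)))}"

text \<open>Functions on the half-line are represented by total functions on the reals whose values at
  negative times are irrelevant; at time 0 the derivative is one-sided.\<close>

definition pie_solution ::
    "('m::finite L2 \<Rightarrow> 'm L2) \<Rightarrow> ('m L2 \<Rightarrow> 'm L2) \<Rightarrow> (real \<Rightarrow> 'm L2) \<Rightarrow> bool" where
  "pie_solution T A x \<longleftrightarrow>
     (\<forall>t\<ge>0. \<exists>x'. (x has_vector_derivative x') (at t within {0..}) \<and> T x' = A (x t))"

definition derivative_along_solutions ::
    "('m::finite L2 \<Rightarrow> 'm L2) \<Rightarrow> ('m L2 \<Rightarrow> 'm L2) \<Rightarrow> ('m L2 \<Rightarrow> real) \<Rightarrow> ('m L2 \<Rightarrow> real) \<Rightarrow> bool" where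
  "derivative_along_solutions T A V V' \<longleftrightarrow>
     (\<forall>x. pie_solution T A x \<longrightarrow> continuous_on {0..} (\<lambda>t. V (x t))) \<and>
     (\<forall>x0 x. pie_solution T A x \<and> x 0 = x0 \<longrightarrow>
        ((\<lambda>h. (V (x h) - V x0) / h) \<longlongrightarrow> V' x0) (at_right 0))"

definition pde_positive :: "('m::finite L2 \<Rightarrow> 'm L2) \<Rightarrow> ('m L2 \<Rightarrow> real) \<Rightarrow> bool" where
  "pde_positive T V \<longleftrightarrow> (\<exists>\<epsilon>>0. \<forall>x. V x \<ge> \<epsilon> * (norm (T x))\<^sup>2)"

definition pie_positive :: "('m::finite L2 \<Rightarrow> real) \<Rightarrow> bool" where
  "pie_positive V \<longleftrightarrow> (\<exists>\<epsilon>>0. \<forall>x. V x \<ge> \<epsilon> * (norm x)\<^sup>2)"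

definition pie_bounded :: "('m::finite L2 \<Rightarrow> real) \<Rightarrow> bool" where
  "pie_bounded V \<longleftrightarrow> (\<exists>C>0. \<forall>x. V x \<le> C * (norm x)\<^sup>2)"

definition pde_bounded :: "('m::finite L2 \<Rightarrow> 'm L2) \<Rightarrow> ('m L2 \<Rightarrow> real) \<Rightarrow> bool" where
  "pde_bounded T V \<longleftrightarrow> (\<exists>C>0. \<forall>x. V x \<le> C * (norm (T x))\<^sup>2)"

definition negative_semidefinite :: "('m::finite L2 \<Rightarrow> real) \<Rightarrow> bool" where
  "negative_semidefinite V' \<longleftrightarrow> (\<forall>x. V' x \<le> 0)"

definition lyapunov_pie_to_pde_stable ::
    "('m::finite L2 \<Rightarrow> 'm L2) \<Rightarrow> ('m L2 \<Rightarrow> 'm L2) \<Rightarrow> bool" where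
  "lyapunov_pie_to_pde_stable T A \<longleftrightarrow>
     (\<exists>C>0. \<forall>x. pie_solution T A x \<longrightarrow> (\<forall>t\<ge>0. norm (T (x t)) \<le> C * norm (x 0)))"

definition lyapunov_pie_stable ::
    "('m::finite L2 \<Rightarrow> 'm L2) \<Rightarrow> ('m L2 \<Rightarrow> 'm L2) \<Rightarrow> bool" where
  "lyapunov_pie_stable T A \<longleftrightarrow>
     (\<exists>C>0. \<forall>x. pie_solution T A x \<longrightarrow> (\<forall>t\<ge>0. norm (x t) \<le> C * norm (x 0)))"

definition lyapunov_pde_stable ::
    "('m::finite L2 \<Rightarrow> 'm L2) \<Rightarrow> ('m L2 \<Rightarrow> 'm L2) \<Rightarrow> bool" where
  "lyapunov_pde_stable T A \<longleftrightarrow>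
     (\<exists>C>0. \<forall>x. pie_solution T A x \<longrightarrow> (\<forall>t\<ge>0. norm (T (x t)) \<le> C * norm (T (x 0))))"

definition lyapunov_pde_to_pie_stable ::
    "('m::finite L2 \<Rightarrow> 'm L2) \<Rightarrow> ('m L2 \<Rightarrow> 'm L2) \<Rightarrow> bool" where
  "lyapunov_pde_to_pie_stable T A \<longleftrightarrow>
     (\<exists>C>0. \<forall>x. pie_solution T A x \<longrightarrow> (\<forall>t\<ge>0. norm (x t) \<le> C * norm (T (x 0))))"

end

theory Submission
  imports Defs
begin

text \<open>The certificate \<open>V\<close> decreases along every solution, and each stability notion is a comparison
  of \<open>V\<close> at time \<open>t\<close> with \<open>V\<close> at time 0: if \<open>\<epsilon> p\<^sup>2 \<le> V \<le> C q\<^sup>2\<close> for two seminorms \<open>p\<close> and \<open>q\<close>,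
  then \<open>\<epsilon> p(x(t))\<^sup>2 \<le> V (x(t)) \<le> V (x(0)) \<le> C q(x(0))\<^sup>2\<close>, so \<open>p(x(t)) \<le> sqrt (C / \<epsilon>) q(x(0))\<close>.
  The four claims are the four ways of choosing \<open>p\<close> and \<open>q\<close> among the PIE norm of \<open>x\<close> and the
  PDE norm of \<open>T x\<close>.

  Two points need an argument. The derivative of \<open>V\<close> is given only at the initial time of a solution;
  because the equation is autonomous, a solution restarted at time \<open>t\<close> is again a solution, so the
  derivative is available at every time (\<open>pie_solution_shift\<close>). Moreover it is only a right
  derivative, so the mean value theorem does not apply; continuity of \<open>t \<mapsto> V (x(t))\<close> is what makes
  a nonpositive right derivative force decrease (\<open>nonpos_right_derivative_imp_le\<close>).\<close>

text \<open>If \<open>f\<close> rose from \<open>a\<close> to \<open>b\<close>, it would end strictly above a line of positive slope through its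
  starting point. Just after the last time at which \<open>f\<close> lies on or below that line it grows
  at least as fast as the line, so the right derivative there would be positive.\<close>

lemma nonpos_right_derivative_imp_le:
  fixes f :: "real \<Rightarrow> real"
  assumes "a \<le> b" and cont: "continuous_on {a..b} f"
    and deriv: "\<And>t. a \<le> t \<Longrightarrow> t < b \<Longrightarrow>
      \<exists>D\<le>0. ((\<lambda>h. (f (t + h) - f t) / h) \<longlongrightarrow> D) (at_right 0)"
  shows "f b \<le> f a"
proof (rule ccontr)
  assume "\<not> f b \<le> f a"
  then have rise: "f b > f a" by simp
  with \<open>a \<le> b\<close> have "a < b" by (cases "a = b") auto
  define e where "e = (f b - f a) / (2 * (b - a))"
  have "e > 0" using rise \<open>a < b\<close> by (simp add: e_def)
  define g where "g t = f t - f a - e * (t - a)" for t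
  have "e * (b - a) = (f b - f a) / 2" using \<open>a < b\<close> by (simp add: e_def field_simps)
  then have "g b > 0" using rise by (simp add: g_def)
  define S where "S = {t \<in> {a..b}. g t \<le> 0}"
  have "continuous_on {a..b} g" unfolding g_def by (intro continuous_intros cont)
  then have "closed ({a..b} \<inter> g -` {..0})"
    by (rule continuous_closed_preimage) auto
  moreover have "S = {a..b} \<inter> g -` {..0}" by (auto simp: S_def)
  ultimately have "closed S" by simp
  moreover have "bounded S"
    by (rule bounded_subset[OF bounded_closed_interval[of a b]]) (auto simp: S_def)
  ultimately have "compact S" by (simp add: compact_eq_bounded_closed)
  moreover have "a \<in> S" using \<open>a < b\<close> by (simp add: S_def g_def)
  ultimately obtain c where "c \<in> S" and c_max: "\<And>t. t \<in> S \<Longrightarrow> t \<le> c"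
    using compact_attains_sup[of S] by blast
  then have c: "a \<le> c" "c \<le> b" "g c \<le> 0" by (auto simp: S_def)
  with \<open>g b > 0\<close> have "c < b" by (cases "c = b") auto
  then obtain D where "D \<le> 0"
    and D: "((\<lambda>h. (f (c + h) - f c) / h) \<longlongrightarrow> D) (at_right 0)"
    using deriv c by blast
  have "eventually (\<lambda>h. (f (c + h) - f c) / h \<ge> e) (at_right 0)"
    unfolding eventually_at_right_field
  proof (intro exI conjI allI impI)
    show "0 < b - c" using \<open>c < b\<close> by simp
    fix h :: real assume h: "0 < h" "h < b - c"
    then have "c + h \<notin> S" using c_max[of "c + h"] by auto
    then have "g (c + h) > 0" using h c by (auto simp: S_def)
    then have "f (c + h) - f c \<ge> e * h" using c by (simp add: g_def algebra_simps)
    then show "(f (c + h) - f c) / h \<ge> e" using h by (simp add: pos_le_divide_eq)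
  qed
  then have "e \<le> D" by (rule tendsto_lowerbound[OF D]) simp
  with \<open>e > 0\<close> \<open>D \<le> 0\<close> show False by simp
qed

text \<open>Restarting at \<open>c\<close> maps the half-line into itself, so the one-sided derivative at the new time 0
  is inherited from the derivative of the original solution at \<open>c\<close>.\<close>

lemma pie_solution_shift:
  assumes "pie_solution T A x" and "c \<ge> 0"
  shows "pie_solution T A (\<lambda>t. x (c + t))"
  unfolding pie_solution_def
proof (intro allI impI)
  fix t :: real assume "t \<ge> 0"
  with assms obtain x' where x': "(x has_vector_derivative x') (at (c + t) within {0..})"
    and eq: "T x' = A (x (c + t))"
    unfolding pie_solution_def by (meson add_nonneg_nonneg)
  have "(x has_vector_derivative x') (at (c + t) within (+) c ` {0..})"
    by (rule has_vector_derivative_within_subset[OF x']) (use \<open>c \<ge> 0\<close> in auto)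
  moreover have "((+) c has_vector_derivative 1) (at t within {0..})"
    by (auto intro!: derivative_eq_intros)
  ultimately have "((\<lambda>t. x (c + t)) has_vector_derivative x') (at t within {0..})"
    using vector_diff_chain_within[of "(+) c" 1 t "{0..}" x x'] by (simp add: o_def)
  with eq show "\<exists>x'. ((\<lambda>t. x (c + t)) has_vector_derivative x') (at t within {0..})
      \<and> T x' = A (x (c + t))" by blast
qed

lemma lyapunov_function_decreases:
  assumes "derivative_along_solutions T A V V'" and "negative_semidefinite V'"
    and sol: "pie_solution T A x" and "t \<ge> 0"
  shows "V (x t) \<le> V (x 0)"
proof (rule nonpos_right_derivative_imp_le[of 0 t "\<lambda>t. V (x t)"])
  show "0 \<le> t" by fact
  have "continuous_on {0..} (\<lambda>t. V (x t))"
    using assms by (simp add: derivative_along_solutions_def)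
  then show "continuous_on {0..t} (\<lambda>t. V (x t))"
    by (rule continuous_on_subset) auto
  fix s :: real assume "0 \<le> s"
  then have "pie_solution T A (\<lambda>h. x (s + h))"
    by (rule pie_solution_shift[OF sol])
  then have "((\<lambda>h. (V (x (s + h)) - V (x s)) / h) \<longlongrightarrow> V' (x s)) (at_right 0)"
    using assms(1)[unfolded derivative_along_solutions_def, THEN conjunct2,
        rule_format, of "\<lambda>h. x (s + h)" "x s"] by simp
  moreover have "V' (x s) \<le> 0" using assms(2) by (simp add: negative_semidefinite_def)
  ultimately show "\<exists>D\<le>0. ((\<lambda>h. (V (x (s + h)) - V (x s)) / h) \<longlongrightarrow> D) (at_right 0)"
    by blast
qed

text \<open>The common form of the four stability claims, with \<open>p\<close> the size that is to be controlled and
  \<open>q\<close> the size in which the initial state is measured.\<close>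

lemma lyapunov_estimate:
  fixes p q :: "'m::finite L2 \<Rightarrow> real"
  assumes "derivative_along_solutions T A V V'" and "negative_semidefinite V'"
    and lower: "\<exists>\<epsilon>>0. \<forall>x. V x \<ge> \<epsilon> * (p x)\<^sup>2" and upper: "\<exists>C>0. \<forall>x. V x \<le> C * (q x)\<^sup>2"
    and q_nonneg: "\<And>x. q x \<ge> 0"
  shows "\<exists>K>0. \<forall>x. pie_solution T A x \<longrightarrow> (\<forall>t\<ge>0. p (x t) \<le> K * q (x 0))"
proof -
  obtain \<epsilon> C where "\<epsilon> > 0" and \<epsilon>: "\<And>x. V x \<ge> \<epsilon> * (p x)\<^sup>2"
    and "C > 0" and C: "\<And>x. V x \<le> C * (q x)\<^sup>2"
    using lower upper by blast
  have "p (x t) \<le> sqrt (C / \<epsilon>) * q (x 0)" if "pie_solution T A x" "t \<ge> 0" for x t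
  proof (rule power2_le_imp_le)
    have "\<epsilon> * (p (x t))\<^sup>2 \<le> V (x t)" by (rule \<epsilon>)
    also have "\<dots> \<le> V (x 0)"
      by (rule lyapunov_function_decreases[OF assms(1,2) that])
    also have "\<dots> \<le> C * (q (x 0))\<^sup>2" by (rule C)
    finally show "(p (x t))\<^sup>2 \<le> (sqrt (C / \<epsilon>) * q (x 0))\<^sup>2"
      using \<open>\<epsilon> > 0\<close> \<open>C > 0\<close> by (simp add: power_mult_distrib field_simps)
    show "0 \<le> sqrt (C / \<epsilon>) * q (x 0)" using \<open>\<epsilon> > 0\<close> \<open>C > 0\<close> q_nonneg by simp
  qed
  moreover have "sqrt (C / \<epsilon>) > 0" using \<open>\<epsilon> > 0\<close> \<open>C > 0\<close> by simp
  ultimately show ?thesis by blast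
qed

theorem lemma3:
  fixes T A :: "'m::finite L2 \<Rightarrow> 'm L2"
    and V V' :: "'m L2 \<Rightarrow> real"
  assumes "T \<in> \<Pi>\<^sub>3" and "A \<in> \<Pi>\<^sub>3"
    and "\<forall>x. V x \<ge> 0" and "V 0 = 0"
    and "derivative_along_solutions T A V V'"
  shows "(pde_positive T V \<and> pie_bounded V \<and> negative_semidefinite V'
            \<longrightarrow> lyapunov_pie_to_pde_stable T A)
       \<and> (pie_positive V \<and> pie_bounded V \<and> negative_semidefinite V'
            \<longrightarrow> lyapunov_pie_stable T A)
       \<and> (pde_positive T V \<and> pde_bounded T V \<and> negative_semidefinite V'
            \<longrightarrow> lyapunov_pde_stable T A)
       \<and> (pie_positive V \<and> pde_bounded T V \<and> negative_semidefinite V'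
            \<longrightarrow> lyapunov_pde_to_pie_stable T A)"
proof (intro conjI impI; elim conjE)
  note estimate = lyapunov_estimate[OF \<open>derivative_along_solutions T A V V'\<close>]
  assume neg: "negative_semidefinite V'"
  show "lyapunov_pie_to_pde_stable T A" if "pde_positive T V" "pie_bounded V"
    using estimate[OF neg, of "\<lambda>x. norm (T x)" norm] that
    unfolding pde_positive_def pie_bounded_def lyapunov_pie_to_pde_stable_def by simp
  show "lyapunov_pie_stable T A" if "pie_positive V" "pie_bounded V"
    using estimate[OF neg, of norm norm] that
    unfolding pie_positive_def pie_bounded_def lyapunov_pie_stable_def by simp
  show "lyapunov_pde_stable T A" if "pde_positive T V" "pde_bounded T V"
    using estimate[OF neg, of "\<lambda>x. norm (T x)" "\<lambda>x. norm (T x)"] that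
    unfolding pde_positive_def pde_bounded_def lyapunov_pde_stable_def by simp
  show "lyapunov_pde_to_pie_stable T A" if "pie_positive V" "pde_bounded T V"
    using estimate[OF neg, of norm "\<lambda>x. norm (T x)"] that
    unfolding pie_positive_def pde_bounded_def lyapunov_pde_to_pie_stable_def by simp
qed

end
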